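(* The class of TRVGs is a proper subclass of the class of ITRVGs: every TRVG is an ITRVG, and there exists an ITRVG that is not a TRVG.
   Context: A (finite, simple) graph $G$ is a transparent rectangle visibility graph (TRVG) if there is an assignment of a rectangle $R_v$ in the plane to each vertex $v$, where each $R_v$ is a nondegenerate closed rectangle with sides parallel to the coordinate axes and distinct rectangles have disjoint interiors, such that for all distinct vertices $u,v$: $u$ and $v$ are adjacent if and only if there is a horizontal line or a vertical line meeting the interiors of both $R_u$ and $R_v$. A graph is an intersecting transparent rectangle visibility graph (ITRVG) if it has such a representation in which the rectangles are allowed to intersect (the requirement that interiors be disjoint is dropped), with the same adjacency rule. *)

theory Defs
  imports "HOL-Analysis.Analysis" "Graph_Theory.Pair_Digraph"
begin

definition axis_rectangle :: "(real \<times> real) set \<Rightarrow> bool" where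
  "axis_rectangle S \<longleftrightarrow> (\<exists>a b c d. a < b \<and> c < d \<and> S = {a..b} \<times> {c..d})"

definition horizontal_line :: "(real \<times> real) set \<Rightarrow> bool" where
  "horizontal_line L \<longleftrightarrow> (\<exists>y. L = UNIV \<times> {y})"

definition vertical_line :: "(real \<times> real) set \<Rightarrow> bool" where
  "vertical_line L \<longleftrightarrow> (\<exists>x. L = {x} \<times> UNIV)"

definition transparently_visible :: "(real \<times> real) set \<Rightarrow> (real \<times> real) set \<Rightarrow> bool" where
  "transparently_visible S T \<longleftrightarrow>
    (\<exists>L. (horizontal_line L \<or> vertical_line L) \<and> L \<inter> interior S \<noteq> {} \<and> L \<inter> interior T \<noteq> {})"

text \<open>
  A finite simple graph is a \<^locale>\<open>pair_graph\<close>, that is, a finite loopless symmetric digraph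
  whose arcs are ordered pairs: vertices \<open>u\<close> and \<open>v\<close> are adjacent iff \<open>(u, v) \<in> parcs G\<close>.
  The values of a representation outside \<open>pverts G\<close> are irrelevant.
\<close>

definition ITRVG_representation ::
    "'a pair_pre_digraph \<Rightarrow> ('a \<Rightarrow> (real \<times> real) set) \<Rightarrow> bool" where
  "ITRVG_representation G R \<longleftrightarrow>
    (\<forall>v \<in> pverts G. axis_rectangle (R v)) \<and>
    (\<forall>u \<in> pverts G. \<forall>v \<in> pverts G. u \<noteq> v \<longrightarrow>
      ((u, v) \<in> parcs G \<longleftrightarrow> transparently_visible (R u) (R v)))"

definition TRVG_representation ::
    "'a pair_pre_digraph \<Rightarrow> ('a \<Rightarrow> (real \<times> real) set) \<Rightarrow> bool" where
  "TRVG_representation G R \<longleftrightarrow>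
    (\<forall>v \<in> pverts G. axis_rectangle (R v)) \<and>
    (\<forall>u \<in> pverts G. \<forall>v \<in> pverts G. u \<noteq> v \<longrightarrow> interior (R u) \<inter> interior (R v) = {}) \<and>
    (\<forall>u \<in> pverts G. \<forall>v \<in> pverts G. u \<noteq> v \<longrightarrow>
      ((u, v) \<in> parcs G \<longleftrightarrow> transparently_visible (R u) (R v)))"

definition TRVG :: "'a pair_pre_digraph \<Rightarrow> bool" where
  "TRVG G \<longleftrightarrow> pair_graph G \<and> (\<exists>R. TRVG_representation G R)"

definition ITRVG :: "'a pair_pre_digraph \<Rightarrow> bool" where
  "ITRVG G \<longleftrightarrow> pair_graph G \<and> (\<exists>R. ITRVG_representation G R)"

end

theory Submission
  imports Defs
begin

text \<open>
  A rectangle is a pair of intervals, so an ITRVG is a union of two interval graphs on the same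
  vertex set, and a TRVG is an edge-disjoint union of two interval graphs. We exhibit an edge
  \<open>uv\<close> that has to lie in both interval graphs.

  Take ten induced 4-cycles \<open>w p w' p'\<close>, pairwise disjoint and non-adjacent, and join \<open>u\<close> and
  \<open>v\<close> to all the \<open>w\<close>s but to none of the \<open>p\<close>s. If \<open>w\<close> sees both \<open>u\<close> and one of its \<open>p\<close>s in the
  same direction, then \<open>w\<close> sticks out of \<open>u\<close>, so it covers one of the eight endpoints of
  intervals of \<open>u\<close> and \<open>v\<close>. Since the \<open>w\<close>s are independent, this spoils at most eight of the
  ten cycles. In the other two, each \<open>w\<close> sees \<open>u\<close> and \<open>v\<close> in one direction and its \<open>p\<close>s in
  the other one. As an interval graph has no induced 4-cycle, the two \<open>w\<close>s of a cycle do
  this in opposite ways. Hence in each direction two non-adjacent \<open>w\<close>s see both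
  \<open>u\<close> and \<open>v\<close>, and \<open>u\<close> and \<open>v\<close> overlap in each direction, again for lack of an induced 4-cycle.
\<close>

section \<open>Overlap of open intervals and the combinatorial core\<close>

definition meets :: "('a \<Rightarrow> real) \<Rightarrow> ('a \<Rightarrow> real) \<Rightarrow> 'a \<Rightarrow> 'a \<Rightarrow> bool" where
  "meets l h x y \<longleftrightarrow> l x < h y \<and> l y < h x"

text \<open>Say \<open>h a \<le> l b\<close>. Then both \<open>x\<close> and \<open>y\<close> begin
  before \<open>h a\<close> and end after \<open>l b\<close>, so they overlap across the
  gap.\<close>

lemma meets_no_induced_C4:
  assumes "meets l h x a" "meets l h x b" "meets l h y a" "meets l h y b" "\<not> meets l h a b"
  shows "meets l h x y"
  using assms unfolding meets_def by linarith

text \<open>\<open>p\<close> lies on one side of \<open>x\<close>, so \<open>w\<close>, reaching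
  from \<open>p\<close> into \<open>x\<close>, passes the end of \<open>x\<close> that faces
  \<open>p\<close>.\<close>

lemma meets_endpoint_covered:
  assumes "meets l h x w" "meets l h w p" "\<not> meets l h p x"
  shows "\<exists>e \<in> {l x, h x}. l w < e \<and> e < h w"
  using assms unfolding meets_def by fastforce

lemma meets_common_point:
  assumes "l x < e" "e < h x" "l y < e" "e < h y"
  shows "meets l h x y"
  using assms by (simp add: meets_def)

text \<open>Edges are assumed in some unknown direction, non-edges in both, so that the coordinates
  of any TRVG representation of the witness can be plugged in.\<close>

lemma forced_double_overlap:
  fixes lo hi :: "bool \<Rightarrow> 'a \<Rightarrow> real" and w p :: "nat \<Rightarrow> bool \<Rightarrow> 'a"
  defines "M \<equiv> \<lambda>d. meets (lo d) (hi d)"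
  assumes xw: "\<And>x i s. x \<in> {u, v} \<Longrightarrow> i < 10 \<Longrightarrow> \<exists>d. M d x (w i s)"
    and wp: "\<And>i s t. i < 10 \<Longrightarrow> \<exists>d. M d (w i s) (p i t)"
    and px: "\<And>x i t d. x \<in> {u, v} \<Longrightarrow> i < 10 \<Longrightarrow> \<not> M d (p i t) x"
    and ww: "\<And>i j s t d. i < 10 \<Longrightarrow> j < 10 \<Longrightarrow> (i, s) \<noteq> (j, t) \<Longrightarrow> \<not> M d (w i s) (w j t)"
    and pp: "\<And>i d. i < 10 \<Longrightarrow> \<not> M d (p i False) (p i True)"
  shows "M d u v"
proof -
  \<comment> \<open>Endpoints are tagged with their direction, since equal values in different
    directions are different obstacles.\<close>
  define ends where "ends = Sigma UNIV (\<lambda>d. {lo d u, hi d u, lo d v, hi d v})"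
  define covers where "covers i k \<longleftrightarrow> k \<in> ends \<and>
    (\<exists>s. lo (fst k) (w i s) < snd k \<and> snd k < hi (fst k) (w i s))" for i k
  define bad where "bad = {i. i < 10 \<and> (\<exists>k. covers i k)}"
  have "finite ends"
    by (simp add: ends_def)
  have "card ends = (\<Sum>d\<in>UNIV. card {lo d u, hi d u, lo d v, hi d v})"
    by (simp add: ends_def)
  also have "\<dots> \<le> (\<Sum>d\<in>(UNIV :: bool set). 4)"
    by (intro sum_mono) (simp add: card_insert_if)
  finally have card_ends: "card ends \<le> 8"
    by simp
  obtain f where f: "\<And>i. i \<in> bad \<Longrightarrow> covers i (f i)"
    using bchoice[of bad covers] by (auto simp: bad_def)
  \<comment> \<open>An endpoint covered from two cycles would be a common point of two
    \<open>w\<close>s.\<close>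
  have "inj_on f bad"
  proof (rule inj_onI, rule ccontr)
    fix i j assume ij: "i \<in> bad" "j \<in> bad" "f i = f j" "i \<noteq> j"
    obtain s t where
      "lo (fst (f i)) (w i s) < snd (f i)" "snd (f i) < hi (fst (f i)) (w i s)"
      "lo (fst (f i)) (w j t) < snd (f i)" "snd (f i) < hi (fst (f i)) (w j t)"
      using f[OF ij(1)] f[OF ij(2)] ij(3) unfolding covers_def by auto
    hence "M (fst (f i)) (w i s) (w j t)"
      unfolding M_def by (rule meets_common_point)
    thus False
      using ww[of i j s t] ij by (auto simp: bad_def)
  qed
  moreover have "f ` bad \<subseteq> ends"
    using f by (auto simp: covers_def)
  ultimately have "card bad \<le> 8"
    using card_inj_on_le \<open>finite ends\<close> card_ends by (metis le_trans)
  moreover have "card ({..<10} - bad) = 10 - card bad"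
    by (subst card_Diff_subset) (auto simp: bad_def)
  ultimately have "2 \<le> card ({..<10} - bad)"
    by simp
  then obtain i j where ij: "i < 10" "i \<notin> bad" "j < 10" "j \<notin> bad" "i \<noteq> j"
    by (auto simp: numeral_2_eq_2 card_le_Suc_iff)
  have excl: "\<not> (M d x (w i s) \<and> M d (w i s) (p i t))"
    if i: "i < 10" "i \<notin> bad" and x: "x \<in> {u, v}" for i s t d x
  proof
    assume "M d x (w i s) \<and> M d (w i s) (p i t)"
    then obtain e where "e \<in> {lo d x, hi d x}" "lo d (w i s) < e" "e < hi d (w i s)"
      using meets_endpoint_covered px[OF x i(1)] unfolding M_def by metis
    hence "covers i (d, e)"
      using x by (auto simp: covers_def ends_def)
    thus False
      using i by (auto simp: bad_def)
  qed
  have direction: "\<exists>d. M d u (w i s) \<and> M d v (w i s) \<and> (\<forall>t. M (\<not> d) (w i s) (p i t))"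
    if "i < 10" "i \<notin> bad" for i s
  proof -
    obtain d where d: "M d u (w i s)"
      using xw[of u i s] \<open>i < 10\<close> by auto
    have p: "M (\<not> d) (w i s) (p i t)" for t
    proof -
      obtain d' where d': "M d' (w i s) (p i t)"
        using wp[of i s t] \<open>i < 10\<close> by auto
      with excl[OF that, of u d s t] d have "d' = (\<not> d)" by (cases d; cases d') auto
      with d' show ?thesis by simp
    qed
    obtain d' where d': "M d' v (w i s)"
      using xw[of v i s] \<open>i < 10\<close> by auto
    with excl[OF that, of v "\<not> d" s] p have "d' = d" by (cases d; cases d') auto
    with d' have "M d v (w i s)" by simp
    with d p show ?thesis by blast
  qed
  \<comment> \<open>Otherwise both \<open>w\<close>s of the cycle meet both \<open>p\<close>s in
    direction \<open>d\<close>, and the disjoint \<open>p\<close>s force the \<open>w\<close>s to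
    meet.\<close>
  have "\<exists>s. M d u (w i s) \<and> M d v (w i s)" if i: "i < 10" "i \<notin> bad" for i
  proof (rule ccontr)
    assume no: "\<not> ?thesis"
    have wp_d: "M d (w i s) (p i t)" for s t
    proof -
      obtain d' where d': "M d' u (w i s)" "M d' v (w i s)" "M (\<not> d') (w i s) (p i t)"
        using direction[OF i, of s] by auto
      with no have "(\<not> d') = d" by (cases d; cases d') auto
      with d' show ?thesis by simp
    qed
    have "M d (w i False) (w i True)"
      using wp_d[of False False] wp_d[of False True] wp_d[of True False] wp_d[of True True] pp[OF i(1)]
      unfolding M_def by (rule meets_no_induced_C4)
    thus False
      using ww[of i i False True] i by simp
  qed
  \<comment> \<open>One cycle yields only one such \<open>w\<close> in direction \<open>d\<close>;
    the second good cycle supplies another, disjoint from it.\<close>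
  then obtain s t where "M d u (w i s)" "M d v (w i s)" "M d u (w j t)" "M d v (w j t)"
    using ij by metis
  moreover have "\<not> M d (w i s) (w j t)"
    using ww ij by simp
  ultimately show ?thesis
    using meets_no_induced_C4 unfolding M_def by metis
qed

section \<open>From rectangles to pairs of intervals\<close>

definition box :: "(bool \<Rightarrow> 'a \<Rightarrow> real) \<Rightarrow> (bool \<Rightarrow> 'a \<Rightarrow> real) \<Rightarrow> 'a \<Rightarrow> (real \<times> real) set" where
  "box lo hi x = {lo False x..hi False x} \<times> {lo True x..hi True x}"

lemma interior_box:
  "interior (box lo hi x) = {lo False x<..<hi False x} \<times> {lo True x<..<hi True x}"
  by (simp add: box_def interior_Times interior_atLeastAtMost_real)

lemma intervals_intersect_iff_meets:
  assumes "l x < h x" "l y < h y"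
  shows "{l x<..<h x} \<inter> {l y<..<h y} \<noteq> {} \<longleftrightarrow> meets l h x y"
  using assms by (auto simp: meets_def)

text \<open>A horizontal line meets both interiors iff its height lies in both y-intervals, which is
  direction \<open>True\<close>; vertical lines give direction \<open>False\<close>.\<close>

lemma transparently_visible_box_iff:
  assumes "\<And>d. lo d x < hi d x" "\<And>d. lo d y < hi d y"
  shows "transparently_visible (box lo hi x) (box lo hi y) \<longleftrightarrow> (\<exists>d. meets (lo d) (hi d) x y)"
proof -
  let ?I = "\<lambda>d z. {lo d z<..<hi d z}"
  have ne: "?I d x \<noteq> {}" "?I d y \<noteq> {}" for d
    using assms[of d] by simp_all
  have lines: "(\<exists>L. (horizontal_line L \<or> vertical_line L) \<and> P L) \<longleftrightarrow>
      (\<exists>c. P (UNIV \<times> {c})) \<or> (\<exists>c. P ({c} \<times> UNIV))" for P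
    by (auto simp: horizontal_line_def vertical_line_def)
  have horizontal: "(\<exists>c. UNIV \<times> {c} \<inter> A \<times> B \<noteq> {} \<and> UNIV \<times> {c} \<inter> A' \<times> B' \<noteq> {}) \<longleftrightarrow> B \<inter> B' \<noteq> {}"
    if "A \<noteq> {}" "A' \<noteq> {}" for A A' B B' :: "real set"
    using that by (auto simp: Times_Int_Times)
  have vertical: "(\<exists>c. {c} \<times> UNIV \<inter> A \<times> B \<noteq> {} \<and> {c} \<times> UNIV \<inter> A' \<times> B' \<noteq> {}) \<longleftrightarrow> A \<inter> A' \<noteq> {}"
    if "B \<noteq> {}" "B' \<noteq> {}" for A A' B B' :: "real set"
    using that by (auto simp: Times_Int_Times)
  have "transparently_visible (box lo hi x) (box lo hi y) \<longleftrightarrow>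
      (\<exists>c. UNIV \<times> {c} \<inter> ?I False x \<times> ?I True x \<noteq> {} \<and> UNIV \<times> {c} \<inter> ?I False y \<times> ?I True y \<noteq> {}) \<or>
      (\<exists>c. {c} \<times> UNIV \<inter> ?I False x \<times> ?I True x \<noteq> {} \<and> {c} \<times> UNIV \<inter> ?I False y \<times> ?I True y \<noteq> {})"
    by (simp only: transparently_visible_def lines interior_box)
  also have "\<dots> \<longleftrightarrow> ?I True x \<inter> ?I True y \<noteq> {} \<or> ?I False x \<inter> ?I False y \<noteq> {}"
    by (simp only: horizontal[OF ne(1)[of False] ne(2)[of False]]
        vertical[OF ne(1)[of True] ne(2)[of True]])
  also have "\<dots> \<longleftrightarrow> (\<exists>d. ?I d x \<inter> ?I d y \<noteq> {})"
    by (metis (full_types))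
  also have "\<dots> \<longleftrightarrow> (\<exists>d. meets (lo d) (hi d) x y)"
    by (simp only: intervals_intersect_iff_meets[of "lo _" _ "hi _", OF assms])
  finally show ?thesis .
qed

text \<open>Disjoint interiors turn into a direction without overlap, because a product is empty iff
  one factor is.\<close>

lemma TRVG_coordinates:
  fixes G :: "'a pair_pre_digraph"
  assumes "TRVG G"
  obtains lo hi :: "bool \<Rightarrow> 'a \<Rightarrow> real" where
    "\<forall>x \<in> pverts G. \<forall>y \<in> pverts G. x \<noteq> y \<longrightarrow>
       ((x, y) \<in> parcs G \<longleftrightarrow> (\<exists>d. meets (lo d) (hi d) x y)) \<and>
       (\<exists>d. \<not> meets (lo d) (hi d) x y)"
proof -
  obtain R where R: "TRVG_representation G R"
    using assms by (auto simp: TRVG_def)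
  hence "\<forall>x\<in>pverts G. \<exists>a b c d. a < b \<and> c < d \<and> R x = {a..b} \<times> {c..d}"
    by (simp add: TRVG_representation_def axis_rectangle_def)
  then obtain a b c d where
    abcd: "\<And>x. x \<in> pverts G \<Longrightarrow> a x < b x \<and> c x < d x \<and> R x = {a x..b x} \<times> {c x..d x}"
    by metis
  define lo :: "bool \<Rightarrow> 'a \<Rightarrow> real" where "lo k = (if k then c else a)" for k
  define hi :: "bool \<Rightarrow> 'a \<Rightarrow> real" where "hi k = (if k then d else b)" for k
  have lohi: "lo k x < hi k x" if "x \<in> pverts G" for k x
    using abcd[OF that] by (simp add: lo_def hi_def)
  have box: "R x = box lo hi x" if "x \<in> pverts G" for x
    using abcd[OF that] by (simp add: lo_def hi_def box_def)
  show thesis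
  proof (intro that ballI impI conjI)
    fix x y assume xy: "x \<in> pverts G" "y \<in> pverts G" "x \<noteq> y"
    have "(x, y) \<in> parcs G \<longleftrightarrow> transparently_visible (R x) (R y)"
      using R xy by (simp add: TRVG_representation_def)
    thus "(x, y) \<in> parcs G \<longleftrightarrow> (\<exists>k. meets (lo k) (hi k) x y)"
      using box lohi xy by (simp add: transparently_visible_box_iff)
    have "interior (box lo hi x) \<inter> interior (box lo hi y) = {}"
      using R xy box by (simp add: TRVG_representation_def)
    thus "\<exists>k. \<not> meets (lo k) (hi k) x y"
      using intervals_intersect_iff_meets lohi xy unfolding interior_box Times_Int_Times
      by (metis Times_empty)
  qed
qed

text \<open>
  The vertices \<open>4 * i + k\<close> with \<open>i < 10\<close> form the \<open>i\<close>-th 4-cycle: \<open>k = 0, 1\<close> are its \<open>w\<close>s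
  and \<open>k = 2, 3\<close> its \<open>p\<close>s. The remaining vertices 40 and 41 are \<open>u\<close> and \<open>v\<close>, both
  drawn as the square of side 10 at the origin. In one direction a \<open>w\<close> lies inside this square,
  in the other one it spans its two \<open>p\<close>s on the negative axis.
\<close>

definition witness_lo :: "bool \<Rightarrow> nat \<Rightarrow> real" where
  "witness_lo d n =
    (let i = real (n div 4); k = n mod 4 in
     if n \<ge> 40 then 0
     else if k = of_bool d then i
     else if k = 3 then - 4 * i - 2
     else - 4 * i - 4)"

definition witness_hi :: "bool \<Rightarrow> nat \<Rightarrow> real" where
  "witness_hi d n =
    (let i = real (n div 4); k = n mod 4 in
     if n \<ge> 40 then 10
     else if k = of_bool d then i + 1
     else if k = 2 then - 4 * i - 3
     else - 4 * i - 1)"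

definition witness_graph :: "nat pair_pre_digraph" where
  "witness_graph = \<lparr>pverts = {..<42},
     parcs = {(m, n). m < 42 \<and> n < 42 \<and> m \<noteq> n \<and> (\<exists>d. meets (witness_lo d) (witness_hi d) m n)}\<rparr>"

lemma pverts_witness_graph [simp]: "pverts witness_graph = {..<42}"
  by (simp add: witness_graph_def)

lemma parcs_witness_graph:
  "(m, n) \<in> parcs witness_graph \<longleftrightarrow>
    m < 42 \<and> n < 42 \<and> m \<noteq> n \<and> (\<exists>d. meets (witness_lo d) (witness_hi d) m n)"
  by (simp add: witness_graph_def)

lemma pair_graph_witness_graph: "pair_graph witness_graph"
proof
  show "finite (parcs witness_graph)"
    by (rule finite_subset[of _ "{..<42} \<times> {..<42}"]) (auto simp: parcs_witness_graph)
  have "sym (parcs witness_graph)"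
    by (rule symI) (auto simp: parcs_witness_graph meets_def)
  thus "symmetric (with_proj witness_graph)"
    by (simp add: symmetric_def arcs_ends_def arc_to_ends_def)
qed (auto simp: parcs_witness_graph)

lemma ITRVG_witness_graph: "ITRVG witness_graph"
proof -
  have lt: "witness_lo d n < witness_hi d n" for d n
    by (simp add: witness_lo_def witness_hi_def Let_def)
  have "axis_rectangle (box witness_lo witness_hi n)" for n
    unfolding axis_rectangle_def box_def using lt by blast
  hence "ITRVG_representation witness_graph (box witness_lo witness_hi)"
    by (simp add: ITRVG_representation_def parcs_witness_graph transparently_visible_box_iff lt)
  thus ?thesis
    using pair_graph_witness_graph by (auto simp: ITRVG_def)
qed

lemma not_TRVG_witness_graph: "\<not> TRVG witness_graph"
proof
  assume "TRVG witness_graph"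
  then obtain lo hi :: "bool \<Rightarrow> nat \<Rightarrow> real" where
    adj: "\<forall>m \<in> pverts witness_graph. \<forall>n \<in> pverts witness_graph. m \<noteq> n \<longrightarrow>
      ((m, n) \<in> parcs witness_graph \<longleftrightarrow> (\<exists>d. meets (lo d) (hi d) m n)) \<and>
      (\<exists>d. \<not> meets (lo d) (hi d) m n)"
    by (rule TRVG_coordinates)
  define w :: "nat \<Rightarrow> bool \<Rightarrow> nat" where "w i s = 4 * i + of_bool s" for i s
  define p :: "nat \<Rightarrow> bool \<Rightarrow> nat" where "p i s = 4 * i + (2 + of_bool s)" for i s
  \<comment> \<open>The given representation may realise an edge in another direction than the
    witness, so only the existential statements agree.\<close>
  have transfer: "(\<exists>d. meets (lo d) (hi d) m n) \<longleftrightarrow>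
      (\<exists>d. meets (witness_lo d) (witness_hi d) m n)" if "m < 42" "n < 42" "m \<noteq> n" for m n
    using adj[rule_format, of m n] that by (simp add: parcs_witness_graph)
  have bounds: "w i s < 40" "p i s < 40" if "i < 10" for i s
    using that by (cases s; simp add: w_def p_def)+
  have divmod: "(4 * i + k) div 4 = i" "(4 * i + k) mod 4 = k" if "k < 4" for i k :: nat
    using that by simp_all
  have w_divmod: "w i s div 4 = i" "w i s mod 4 = of_bool s" for i s
    unfolding w_def by (rule divmod; cases s; simp)+
  have p_divmod: "p i t div 4 = i" "p i t mod 4 = 2 + of_bool t" for i t
    unfolding p_def by (rule divmod; cases t; simp)+
  have w: "witness_lo d (w i s) = (if s = d then real i else - 4 * real i - 4)"
    "witness_hi d (w i s) = (if s = d then real i + 1 else - 4 * real i - 1)"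
    if "i < 10" for d i s
    using bounds(1)[OF that, of s]
    by (cases d; cases s; simp add: w_divmod witness_lo_def witness_hi_def)+
  have p: "witness_lo d (p i t) = - 4 * real i - (if t then 2 else 4)"
    "witness_hi d (p i t) = - 4 * real i - (if t then 1 else 3)"
    if "i < 10" for d i t
    using bounds(2)[OF that, of t]
    by (cases d; cases t; simp add: p_divmod witness_lo_def witness_hi_def)+
  have uv: "witness_lo d 40 = 0" "witness_hi d 40 = 10" "witness_lo d 41 = 0" "witness_hi d 41 = 10"
    for d
    by (simp_all add: witness_lo_def witness_hi_def)
  note coords = meets_def w p uv
  have "meets (lo d) (hi d) 40 41" for d
  proof (rule forced_double_overlap[where lo = lo and hi = hi and w = w and p = p])
    fix x i s assume x: "x \<in> {40, 41::nat}" and i: "i < (10::nat)"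
    have "\<exists>d. meets (witness_lo d) (witness_hi d) x (w i s)"
      \<comment> \<open>\<open>w i s\<close> lies inside the square in direction \<open>s\<close>
        and spans its \<open>p\<close>s in direction \<open>\<not> s\<close>.\<close>
      by (rule exI[of _ s]) (use x i in \<open>auto simp: coords\<close>)
    thus "\<exists>d. meets (lo d) (hi d) x (w i s)"
      using transfer[of x "w i s"] x bounds[OF i, of s] by auto
  next
    fix i s t assume i: "i < (10::nat)"
    have "\<exists>d. meets (witness_lo d) (witness_hi d) (w i s) (p i t)"
      by (rule exI[of _ "\<not> s"]) (simp add: coords i)
    moreover have "w i s \<noteq> p i t"
      using w_divmod(2)[of i s] p_divmod(2)[of i t] by (cases s) auto
    ultimately show "\<exists>d. meets (lo d) (hi d) (w i s) (p i t)"
      using transfer[of "w i s" "p i t"] bounds[OF i, of s] bounds[OF i, of t] by simp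
  next
    fix x i t d assume x: "x \<in> {40, 41::nat}" and i: "i < (10::nat)"
    have "\<not> meets (witness_lo d) (witness_hi d) (p i t) x" for d
      using x i by (auto simp: coords)
    thus "\<not> meets (lo d) (hi d) (p i t) x"
      using transfer[of "p i t" x] x bounds[OF i, of t] by auto
  next
    fix i j :: nat and s t d :: bool assume ij: "i < 10" "j < 10" "(i, s) \<noteq> (j, t)"
    \<comment> \<open>The unit intervals in the square at most touch, the negative blocks of
      different cycles are separated, and in each direction exactly one \<open>w\<close> of a cycle
      is in the square.\<close>
    have "\<not> meets (witness_lo d) (witness_hi d) (w i s) (w j t)" for d
      using ij by (cases i j rule: linorder_cases) (auto simp: coords)
    moreover have "w i s \<noteq> w j t"
      using ij(3) w_divmod[of i s] w_divmod[of j t] by auto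
    ultimately show "\<not> meets (lo d) (hi d) (w i s) (w j t)"
      using transfer[of "w i s" "w j t"] bounds[OF ij(1), of s] bounds[OF ij(2), of t] by auto
  next
    fix i d assume i: "i < (10::nat)"
    have "\<not> meets (witness_lo d) (witness_hi d) (p i False) (p i True)" for d
      by (simp add: coords i)
    moreover have "p i False \<noteq> p i True"
      by (simp add: p_def)
    ultimately show "\<not> meets (lo d) (hi d) (p i False) (p i True)"
      using transfer[of "p i False" "p i True"] bounds[OF i, of False] bounds[OF i, of True] by auto
  qed
  \<comment> \<open>Overlap in both directions contradicts the disjoint interiors encoded in
    \<open>adj\<close>.\<close>
  thus False
    using adj[rule_format, of 40 41] by simp
qed

theorem theorem8:
  shows "(\<forall>G :: 'a pair_pre_digraph. TRVG G \<longrightarrow> ITRVG G) \<and>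
         (\<exists>G :: nat pair_pre_digraph. ITRVG G \<and> \<not> TRVG G)"
proof
  show "\<forall>G :: 'a pair_pre_digraph. TRVG G \<longrightarrow> ITRVG G"
    by (auto simp: TRVG_def ITRVG_def TRVG_representation_def ITRVG_representation_def)
  show "\<exists>G :: nat pair_pre_digraph. ITRVG G \<and> \<not> TRVG G"
    using ITRVG_witness_graph not_TRVG_witness_graph by blast
qed

end
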